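(* For any finite simple graphs $G$ and $H$, (i) $\gamma_R(G\Box H)\ge \frac{2\gamma(G)\gamma_R(H)}{3}$, and (ii) $\gamma_R(G\Box H)\ge \frac{\gamma(G)\gamma_R(H)+\gamma(G\Box H)}{2}$.
   Context: $\gamma(X)$ denotes the domination number of a graph $X$ (minimum size of a set $D$ such that every vertex outside $D$ has a neighbor in $D$). A Roman dominating function on $X$ is a map $f:V(X)\to\{0,1,2\}$ such that every vertex $v$ with $f(v)=0$ has a neighbor $u$ with $f(u)=2$; $\gamma_R(X)$ is the minimum of $\sum_v f(v)$ over such $f$. The Cartesian product $G\Box H$ has vertex set $V(G)\times V(H)$, with $(g,h)\sim(g',h')$ iff ($g=g'$ and $h\sim h'$) or ($g\sim g'$ and $h=h'$). *)

theory Defs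
  imports Complex_Main "Graph_Theory.Pair_Digraph"
begin

(* A finite simple graph is a pair_graph: a finite vertex set together with a symmetric,
   irreflexive relation on it. So (u, v) \<in> parcs X says that u and v are adjacent.
   The definitions below are meant for such graphs only. *)

definition dominating_set :: "'a pair_pre_digraph \<Rightarrow> 'a set \<Rightarrow> bool" where
  "dominating_set X D \<longleftrightarrow>
     D \<subseteq> pverts X \<and> (\<forall>v \<in> pverts X - D. \<exists>u \<in> D. (v, u) \<in> parcs X)"

definition domination_number :: "'a pair_pre_digraph \<Rightarrow> nat" where
  "domination_number X = (LEAST n. \<exists>D. dominating_set X D \<and> card D = n)"

(* Only the values of f on the vertex set matter. *)
definition roman_dominating :: "'a pair_pre_digraph \<Rightarrow> ('a \<Rightarrow> nat) \<Rightarrow> bool" where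
  "roman_dominating X f \<longleftrightarrow>
     (\<forall>v \<in> pverts X. f v \<in> {0, 1, 2}) \<and>
     (\<forall>v \<in> pverts X. f v = 0 \<longrightarrow> (\<exists>u \<in> pverts X. (v, u) \<in> parcs X \<and> f u = 2))"

definition roman_domination_number :: "'a pair_pre_digraph \<Rightarrow> nat" where
  "roman_domination_number X =
     (LEAST n. \<exists>f. roman_dominating X f \<and> (\<Sum>v \<in> pverts X. f v) = n)"

definition cartesian_product ::
    "'a pair_pre_digraph \<Rightarrow> 'b pair_pre_digraph \<Rightarrow> ('a \<times> 'b) pair_pre_digraph" where
  "cartesian_product G H =
     \<lparr> pverts = pverts G \<times> pverts H,
       parcs = {((g, h), (g', h')) | g h g' h'.
                  (g, h) \<in> pverts G \<times> pverts H \<and> (g', h') \<in> pverts G \<times> pverts H \<and>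
                  (g = g' \<and> (h, h') \<in> parcs H \<or> (g, g') \<in> parcs G \<and> h = h')} \<rparr>"

lemma pair_graph_cartesian_product:
  assumes "pair_graph G" "pair_graph H"
  shows "pair_graph (cartesian_product G H)"
proof -
  interpret G: pair_graph G by fact
  interpret H: pair_graph H by fact
  have fin: "finite (pverts G \<times> pverts H)" by simp
  have sub: "parcs (cartesian_product G H)
      \<subseteq> (pverts G \<times> pverts H) \<times> (pverts G \<times> pverts H)"
    by (auto simp: cartesian_product_def)
  have symG: "(x, y) \<in> parcs G \<Longrightarrow> (y, x) \<in> parcs G" for x y
    using G.pair_sym_arcs by (auto simp: symmetric_def dest: symD)
  have symH: "(x, y) \<in> parcs H \<Longrightarrow> (y, x) \<in> parcs H" for x y
    using H.pair_sym_arcs by (auto simp: symmetric_def dest: symD)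
  show ?thesis
  proof
    show "finite (parcs (cartesian_product G H))"
      using sub fin by (meson finite_SigmaI finite_subset)
    show "symmetric (with_proj (cartesian_product G H))"
      by (auto simp: symmetric_def cartesian_product_def intro!: symI intro: symG symH)
  qed (auto simp: cartesian_product_def dest: G.pair_no_loops H.pair_no_loops)
qed

lemma ex_minimum_dominating_set:
  "\<exists>D. dominating_set X D \<and> card D = domination_number X"
proof -
  have "dominating_set X (pverts X)"
    by (simp add: dominating_set_def)
  then have "\<exists>n D. dominating_set X D \<and> card D = n"
    by blast
  then show ?thesis
    unfolding domination_number_def by (rule LeastI_ex)
qed

lemma ex_minimum_roman_dominating:
  "\<exists>f. roman_dominating X f \<and> (\<Sum>v \<in> pverts X. f v) = roman_domination_number X"
proof -
  have "roman_dominating X (\<lambda>_. 1)"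
    by (simp add: roman_dominating_def)
  then have "\<exists>n f. roman_dominating X f \<and> (\<Sum>v \<in> pverts X. f v) = n"
    by blast
  then show ?thesis
    unfolding roman_domination_number_def by (rule LeastI_ex)
qed

end

theory Submission
  imports Defs
begin

text \<open>
  Let \<open>f\<close> be a minimum Roman dominating function of \<open>G \<box> H\<close>, with \<open>V\<^sub>2\<close> the set where it is \<open>2\<close>
  and \<open>V\<^sub>1\<close> the set where it is \<open>1\<close>. Everything follows from
  \<open>\<gamma>(G) \<gamma>\<^sub>R(H) \<le> |V\<^sub>1| + 3 |V\<^sub>2|\<close>, since \<open>V\<^sub>1 \<union> V\<^sub>2\<close> is dominating.
  Partition the vertices of \<open>G\<close> into cells, each dominated by one vertex of a minimum dominating
  set \<open>D\<close>. For each cell, the maximum of \<open>f\<close> over the cell in each layer is a function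
  on \<open>H\<close>, which becomes Roman dominating once it is raised to \<open>1\<close> in those layers in which the
  whole cell is dominated by \<open>V\<^sub>2\<close> within the layer. In a fixed layer there are at most as many
  such cells as vertices of \<open>V\<^sub>2\<close>: otherwise replacing the corresponding vertices of \<open>D\<close>
  by the latter would give a smaller dominating set of \<open>G\<close>.
\<close>

lemma domination_number_le:
  "dominating_set X D \<Longrightarrow> domination_number X \<le> card D"
  unfolding domination_number_def by (rule Least_le) blast

lemma roman_domination_number_le:
  "roman_dominating X f \<Longrightarrow> roman_domination_number X \<le> (\<Sum>v \<in> pverts X. f v)"
  unfolding roman_domination_number_def by (rule Least_le) blast

text \<open>The union of \<open>D - S\<close> and \<open>W\<close> is again dominating, so
  minimality of \<open>D\<close> forbids \<open>W\<close> to be smaller than the removed part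
  \<open>S\<close>.\<close>

lemma domination_number_le_replace:
  assumes D: "dominating_set X D" "card D = domination_number X" "finite D"
    and W: "W \<subseteq> pverts X" "finite W"
    and S: "S \<subseteq> D"
    and dom: "\<And>v. v \<in> pverts X \<Longrightarrow>
      (\<exists>u \<in> D - S. v = u \<or> (v, u) \<in> parcs X) \<or> (\<exists>u \<in> W. (v, u) \<in> parcs X)"
  shows "card S \<le> card W"
proof -
  have "dominating_set X ((D - S) \<union> W)"
    using D(1) W(1) dom unfolding dominating_set_def by blast
  then have "card D \<le> card ((D - S) \<union> W)"
    using domination_number_le D(2) by metis
  also have "\<dots> \<le> card (D - S) + card W"
    by (rule card_Un_le)
  also have "card (D - S) = card D - card S"
    using S D(3) finite_subset by (metis card_Diff_subset)
  finally show ?thesis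
    using card_mono[OF D(3) S] by linarith
qed

lemma domination_times_roman_le:
  fixes G :: "'a pair_pre_digraph" and H :: "'b pair_pre_digraph"
  assumes fin: "finite (pverts G)" "finite (pverts H)"
    and f: "roman_dominating (cartesian_product G H) f"
  shows "domination_number G * roman_domination_number H
    \<le> (\<Sum>v \<in> pverts G \<times> pverts H. f v) + card {v \<in> pverts G \<times> pverts H. f v = 2}"
proof -
  let ?V = "pverts G" and ?U = "pverts H"
  obtain D where D: "dominating_set G D" "card D = domination_number G"
    using ex_minimum_dominating_set by blast
  have DV: "D \<subseteq> ?V"
    using D(1) by (simp add: dominating_set_def)
  then have finD: "finite D"
    using fin(1) finite_subset by blast
  have "\<forall>v \<in> ?V. \<exists>u \<in> D. v = u \<or> (v, u) \<in> parcs G"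
    using D(1) unfolding dominating_set_def by blast
  then obtain p where p: "\<And>v. v \<in> ?V \<Longrightarrow> p v \<in> D \<and> (v = p v \<or> (v, p v) \<in> parcs G)"
    by metis
  define C where "C i = {g \<in> ?V. p g = i}" for i
  \<comment> \<open>Here \<open>g'\<close> ranges over all of \<open>G\<close>, not only over the
    cell. An empty cell satisfies \<open>M\<close> vacuously, and its \<open>F i\<close> is
    constantly 1.\<close>
  define M where "M i h \<longleftrightarrow> (\<forall>g \<in> C i. \<exists>g' \<in> ?V. (g, g') \<in> parcs G \<and> f (g', h) = 2)" for i h
  define F :: "'a \<Rightarrow> 'b \<Rightarrow> nat" where
    "F i h = (if \<exists>g \<in> C i. f (g, h) = 2 then 2
      else if (\<exists>g \<in> C i. f (g, h) = 1) \<or> M i h then 1 else 0)" for i h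
  have finC: "finite (C i)" for i
    using fin(1) by (simp add: C_def)
  have fval: "f (g, h) \<in> {0, 1, 2}" if "g \<in> ?V" "h \<in> ?U" for g h
    using f that by (simp add: roman_dominating_def cartesian_product_def)

  have roman: "roman_dominating H (F i)" for i
    unfolding roman_dominating_def
  proof (intro conjI ballI impI)
    fix h assume h: "h \<in> ?U" and "F i h = 0"
    then have no2: "\<forall>g \<in> C i. f (g, h) \<noteq> 2 \<and> f (g, h) \<noteq> 1" and "\<not> M i h"
      by (auto simp: F_def split: if_splits)
    then obtain g where g: "g \<in> C i"
      and nohor: "\<And>g'. g' \<in> ?V \<Longrightarrow> (g, g') \<in> parcs G \<Longrightarrow> f (g', h) \<noteq> 2"
      unfolding M_def by blast
    have gV: "g \<in> ?V"
      using g by (simp add: C_def)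
    have "f (g, h) = 0"
      using fval[OF gV h] no2 g by auto
    then obtain g' h' where "g' \<in> ?V" "h' \<in> ?U" "f (g', h') = 2"
      "g = g' \<and> (h, h') \<in> parcs H \<or> (g, g') \<in> parcs G \<and> h = h'"
      using f gV h unfolding roman_dominating_def cartesian_product_def by fastforce
    \<comment> \<open>Since \<open>g\<close> has no neighbour of value 2 within layer
      \<open>h\<close>, the one found lies over \<open>g\<close> itself in another layer. It
      therefore stays in the cell, and this forces \<open>F i h' = 2\<close>.\<close>
    then have "h' \<in> ?U" "(h, h') \<in> parcs H" "f (g, h') = 2"
      using nohor by auto
    then show "\<exists>u \<in> ?U. (h, u) \<in> parcs H \<and> F i u = 2"
      using g by (auto simp: F_def)
  qed (auto simp: F_def)

  \<comment> \<open>A value 1 or 2 attained on the cell is a term of the sum; if there is none,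
    \<open>F i h\<close> can be 1 only through \<open>M i h\<close>.\<close>
  have F_le: "F i h \<le> (\<Sum>g \<in> C i. f (g, h)) + of_bool (M i h)" for i h
  proof -
    have "f (g, h) \<le> (\<Sum>g \<in> C i. f (g, h))" if "g \<in> C i" for g
      using member_le_sum[OF that, of "\<lambda>g. f (g, h)"] finC by simp
    then show ?thesis
      unfolding F_def by force
  qed

  have M_le: "(\<Sum>i \<in> D. of_bool (M i h)) \<le> card {g \<in> ?V. f (g, h) = 2}" for h
  proof -
    \<comment> \<open>A vertex \<open>v\<close> whose cell satisfies \<open>M\<close> is dominated
      by the vertices of value 2 in layer \<open>h\<close>; any other \<open>v\<close> keeps
      \<open>p v\<close>, which is not removed from \<open>D\<close>.\<close>
    have "card {i \<in> D. M i h} \<le> card {g \<in> ?V. f (g, h) = 2}"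
    proof (rule domination_number_le_replace[OF D finD])
      fix v assume v: "v \<in> ?V"
      show "(\<exists>u \<in> D - {i \<in> D. M i h}. v = u \<or> (v, u) \<in> parcs G) \<or>
        (\<exists>u \<in> {g \<in> ?V. f (g, h) = 2}. (v, u) \<in> parcs G)"
      proof (cases "M (p v) h")
        case True
        then show ?thesis
          using v unfolding M_def C_def by blast
      next
        case False
        then show ?thesis
          using p[OF v] by blast
      qed
    qed (use fin in auto)
    then show ?thesis
      using finD by (simp add: sum_of_bool_eq Collect_conj_eq)
  qed

  have cells: "(\<Sum>i \<in> D. \<Sum>g \<in> C i. f (g, h)) = (\<Sum>g \<in> ?V. f (g, h))" for h
    unfolding C_def using p by (intro sum.group fin finD) blast
  have layers: "(\<Sum>h \<in> ?U. card {g \<in> ?V. f (g, h) = 2}) = card {v \<in> ?V \<times> ?U. f v = 2}"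
  proof -
    have "{v \<in> ?V \<times> ?U. f v = 2}
        = (\<lambda>(h, g). (g, h)) ` (SIGMA h : ?U. {g \<in> ?V. f (g, h) = 2})"
      by force
    then show ?thesis
      using fin by (simp add: card_image inj_on_def)
  qed
  have "domination_number G * roman_domination_number H \<le> (\<Sum>i \<in> D. \<Sum>h \<in> ?U. F i h)"
    using sum_mono[of D "\<lambda>_. roman_domination_number H" "\<lambda>i. \<Sum>h \<in> ?U. F i h"]
      roman_domination_number_le[OF roman] D(2) by simp
  also have "\<dots> \<le> (\<Sum>i \<in> D. \<Sum>h \<in> ?U. (\<Sum>g \<in> C i. f (g, h)) + of_bool (M i h))"
    by (intro sum_mono F_le)
  \<comment> \<open>The sum over layers moves outside because \<open>M_le\<close> compares cells and
    vertices one layer at a time.\<close>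
  also have "\<dots> = (\<Sum>h \<in> ?U. (\<Sum>g \<in> ?V. f (g, h)) + (\<Sum>i \<in> D. of_bool (M i h)))"
    by (subst sum.swap) (simp only: sum.distrib cells)
  also have "\<dots> \<le> (\<Sum>h \<in> ?U. (\<Sum>g \<in> ?V. f (g, h)) + card {g \<in> ?V. f (g, h) = 2})"
    by (intro sum_mono add_left_mono M_le)
  also have "\<dots> = (\<Sum>v \<in> ?V \<times> ?U. f v) + card {v \<in> ?V \<times> ?U. f v = 2}"
    by (subst sum.distrib, subst sum.swap) (simp add: layers sum.cartesian_product)
  finally show ?thesis .
qed

text \<open>The support of \<open>f\<close> is dominating, and the weight counts each support vertex
  once and those of value 2 once more.\<close>

lemma domination_number_plus_card_le:
  assumes fin: "finite (pverts X)" and f: "roman_dominating X f"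
  shows "domination_number X + card {v \<in> pverts X. f v = 2} \<le> (\<Sum>v \<in> pverts X. f v)"
proof -
  let ?D = "{v \<in> pverts X. f v \<noteq> 0}"
  have "dominating_set X ?D"
    unfolding dominating_set_def
  proof (intro conjI ballI)
    fix v assume "v \<in> pverts X - ?D"
    then obtain u where "u \<in> pverts X" "(v, u) \<in> parcs X" "f u = 2"
      using f unfolding roman_dominating_def by blast
    then show "\<exists>u \<in> ?D. (v, u) \<in> parcs X"
      by (intro bexI[of _ u]) auto
  qed blast
  then have "domination_number X + card {v \<in> pverts X. f v = 2}
      \<le> card ?D + card {v \<in> pverts X. f v = 2}"
    by (simp add: domination_number_le)
  also have "\<dots> = (\<Sum>v \<in> pverts X. of_bool (f v \<noteq> 0) + of_bool (f v = 2))"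
    using fin by (simp add: sum.distrib sum_of_bool_eq Collect_conj_eq)
  also have "\<dots> = (\<Sum>v \<in> pverts X. f v)"
    using f by (intro sum.cong) (auto simp: roman_dominating_def)
  finally show ?thesis .
qed

theorem theorem3:
  fixes G :: "'a pair_pre_digraph" and H :: "'b pair_pre_digraph"
  assumes "pair_graph G" and "pair_graph H"
  shows "real (roman_domination_number (cartesian_product G H))
           \<ge> 2 * real (domination_number G) * real (roman_domination_number H) / 3
       \<and> real (roman_domination_number (cartesian_product G H))
           \<ge> (real (domination_number G) * real (roman_domination_number H)
               + real (domination_number (cartesian_product G H))) / 2"
proof -
  interpret G: pair_graph G by fact
  interpret H: pair_graph H by fact
  let ?P = "cartesian_product G H"
  have vP: "pverts ?P = pverts G \<times> pverts H"
    by (simp add: cartesian_product_def)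
  then have finP: "finite (pverts ?P)"
    by simp
  obtain f where f: "roman_dominating ?P f"
    and w: "(\<Sum>v \<in> pverts ?P. f v) = roman_domination_number ?P"
    using ex_minimum_roman_dominating by blast
  let ?n = "card {v \<in> pverts ?P. f v = 2}"
  have key: "domination_number G * roman_domination_number H \<le> roman_domination_number ?P + ?n"
    using domination_times_roman_le[OF _ _ f] w vP by simp
  have dom: "domination_number ?P + ?n \<le> roman_domination_number ?P"
    using domination_number_plus_card_le[OF finP f] w by simp
  have "2 * ?n = (\<Sum>v \<in> {v \<in> pverts ?P. f v = 2}. f v)"
    by simp
  also have "\<dots> \<le> roman_domination_number ?P"
    unfolding w[symmetric] using finP by (intro sum_mono2) auto
  finally have two: "2 * ?n \<le> roman_domination_number ?P" .
  have "real (domination_number G) * real (roman_domination_number H)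
      \<le> real (roman_domination_number ?P) + real ?n"
    using of_nat_mono[OF key, where 'a = real] by (simp only: of_nat_mult of_nat_add)
  moreover have "real (domination_number ?P) + real ?n \<le> real (roman_domination_number ?P)"
    using dom by linarith
  moreover have "2 * real ?n \<le> real (roman_domination_number ?P)"
    using two by linarith
  \<comment> \<open>With \<open>n \<le> r / 2\<close> the first bound gives
    \<open>x \<le> 3 * r / 2\<close>; adding the first two cancels \<open>n\<close> and gives
    \<open>x + d \<le> 2 * r\<close>.\<close>
  moreover have "2 * x / 3 \<le> r \<and> (x + d) / 2 \<le> r"
    if "x \<le> r + n" "d + n \<le> r" "2 * n \<le> r" for x r n d :: real
    using that by simp
  ultimately show ?thesis
    unfolding mult.assoc by blast
qed

end
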